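(* Signal temporal dynamic logic (STdL) is non-axiomatizable: there is no effective proof calculus that is sound and complete for the valid STdL formulas.
   Context: STdL formulas are interpreted over hybrid programs. States are functions from variables to $\mathbb{R}$; $\Lambda$ is an error state. Hybrid programs: $\alpha,\beta::=x:=\theta\mid ?\chi\mid x'=\theta\ \&\ \chi\mid\alpha\cup\beta\mid\alpha;\beta\mid\alpha^*$, with $\theta$ polynomials with rational coefficients and $\chi$ first-order real-arithmetic formulas. Each program has a set $[\![\alpha]\!]$ of traces: a trace is a finite sequence $(\sigma_0,\dots,\sigma_n)$ of functions $\sigma_i:[r_{i-1},r_i]\to$ states ($0=r_{-1}\le r_0\le\cdots$), the last piece possibly defined on $[r_{n-1},+\infty)$ (infinite trace) or being the single error state $\Lambda$ at time $r_{n-1}$ with $n\ge1$ (error trace); otherwise it is terminating. Lengths $|\sigma|$ are $r_n$, $+\infty$, $r_{n-1}$ respectively. Assignments produce $(\hat v,\hat w)$ with $w=v[x\mapsto val(v,\theta)]$ (here $\hat v$ is the map $[0,0]\to\{v\}$); ODEs produce the differentiable solutions on $[0,r]$ or $[0,\infty)$ staying in $\chi$, plus $(\hat v,\hat\Lambda)$ if $v\not\models\chi$; tests produce $(\hat v)$ if $v\models\chi$, else $(\hat v,\hat\Lambda)$; $\cup$ is union; $;$ concatenates a terminating trace with a time-shifted trace of the second program starting in its last state (non-terminating traces of the first program are kept as is); $\alpha^*$ is the union over $n$ of $n$-fold sequential repetition ($\alpha^0={?}\mathit{true}$). Syntax: state formulas $\phi,\psi::=\theta_1\ge\theta_2\mid\neg\phi\mid\phi\wedge\psi\mid\forall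 x.\phi\mid[\alpha]\pi\mid[\alpha]\xi\mid\langle\alpha\rangle\xi$; trace formulas $\pi::=\phi\mid\neg\pi\mid\square_{[a,b]}\phi$; normalized trace formulas $\xi::=\phi\sqcap\square_{[a,b]}\psi\mid\phi\sqcup\lozenge_{[a,b]}\psi$; interval bounds $a,b::=\theta\mid\max(\theta_1,\theta_2)\mid\min(\theta_1,\theta_2)\mid a+b\mid a-b$, evaluated in the first state of the trace. Abbreviations: $\lozenge_{[a,b]}\phi\equiv\neg\square_{[a,b]}\neg\phi$, $\langle\alpha\rangle\pi\equiv\neg[\alpha]\neg\pi$, $\vee,\exists$ as usual. Lengths: $\|\phi\|=0$, $\|\neg\pi\|=\|\pi\|$, $\|\square_{[a,b]}\phi\|=b$, $\|\phi\sqcap\square_{[a,b]}\psi\|=\|\phi\sqcup\lozenge_{[a,b]}\psi\|=b$. Semantics: comparisons, $\neg,\wedge,\forall$ as usual in first-order real arithmetic. For $\phi$ a state formula, $v\models[\alpha]\phi$ iff every terminating $\sigma\in[\![\alpha]\!]$ with $\mathrm{first}\,\sigma=v$ has $\mathrm{last}\,\sigma\models\phi$. For $\pi$ a (non-state) trace formula, $v\models[\alpha]\pi$ iff every $\sigma\in[\![\alpha]\!]$ with $\mathrm{first}\,\sigma=v$ and $|\sigma|\ge\|\pi\|$ satisfies $\sigma\models\pi$. Trace satisfaction: $(\sigma,(i,t))\models\phi$ iff $|\sigma|\ge t$ and $\sigma_i(t)\models\phi$; negation pointwise; $(\sigma,(i,t))\models\square_{[a,b]}\phi$ iff for all $t'\in[t+a,t+b]$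 and all $i$ with $t'$ in the domain of $\sigma_i$ (and $\sigma_i$ not the error piece), $(\sigma,(i,t'))\models\phi$; $\sigma\models\pi$ means $(\sigma,(0,0))\models\pi$. $\sigma\models\phi\sqcap\square_{[a,b]}\psi$ iff, if $\sigma$ terminates, $\mathrm{last}\,\sigma\models\phi$ and $\sigma\models\square_{[a,b]}\psi$, and otherwise $\sigma\models\square_{[a,b]}\psi$; $\sigma\models\phi\sqcup\lozenge_{[a,b]}\psi$ iff, if $\sigma$ terminates, $\mathrm{last}\,\sigma\models\phi$ or $\sigma\models\lozenge_{[a,b]}\psi$, and otherwise $\sigma\models\lozenge_{[a,b]}\psi$. $v\models[\alpha]\xi$ iff for each $\sigma\in[\![\alpha]\!]$ with $\mathrm{first}\,\sigma=v$: if $\sigma$ terminates then $\mathrm{last}\,\sigma\models\xi_{sta}$ (the state-formula part of $\xi$), and if $|\sigma|\ge\|\xi\|$ then $\sigma\models\xi$; $v\models\langle\alpha\rangle\xi$ iff some such $\sigma$ has (if terminating) $\mathrm{last}\,\sigma\models\xi_{sta}$, $|\sigma|\ge\|\xi\|$ and $\sigma\models\xi$. A formula is valid if it holds in all states. *)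

theory Defs
  imports
    Complex_Main
    "HOL-Library.Extended_Real"
    "HOL-Library.Nat_Bijection"
begin

section \<open>Syntax\<close>

type_synonym var = nat
type_synonym state = "var \<Rightarrow> real"

datatype trm =
    Const rat
  | Var var
  | Plus trm trm
  | Times trm trm

datatype fol =
    FGeq trm trm
  | FNot fol
  | FAnd fol fol
  | FAll var fol

datatype prog =
    Assign var trm
  | Test fol
  | ODE var trm fol
  | Choice prog prog
  | Seq prog prog
  | Loop prog

datatype bound =
    BTrm trm
  | BMax trm trm
  | BMin trm trm
  | BAdd bound bound
  | BSub bound bound

text \<open>
  Read literally, the grammar of trace formulas \<open>\<pi> ::= \<phi> | \<not>\<pi> | \<box>\<^bsub>[a,b]\<^esub>\<phi>\<close> produces every
  \<open>\<not>\<phi>\<close> with \<open>\<phi>\<close> a state formula twice, while the semantics of \<open>[\<alpha>]\<pi>\<close> depends on whether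
  \<open>\<pi>\<close> is a state formula. To have unique parse trees, \<open>tfml\<close> contains exactly the trace formulas
  that are not state formulas, and \<open>[\<alpha>]\<pi>\<close> is \<open>BoxS\<close> if \<open>\<pi>\<close> is a state formula and \<open>BoxT\<close>
  otherwise. \<open>BoxN\<close> and \<open>DiaN\<close> are \<open>[\<alpha>]\<xi>\<close> and \<open>\<langle>\<alpha>\<rangle>\<xi>\<close>; \<open>AndAlways \<phi> a b \<psi>\<close> and
  \<open>OrEventually \<phi> a b \<psi>\<close> are \<open>\<phi> \<sqinter> \<box>\<^bsub>[a,b]\<^esub>\<psi>\<close> and \<open>\<phi> \<squnion> \<diamond>\<^bsub>[a,b]\<^esub>\<psi>\<close>.
\<close>

datatype sfml =
    Geq trm trm
  | Not sfml
  | And sfml sfml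
  | All var sfml
  | BoxS prog sfml
  | BoxT prog tfml
  | BoxN prog nfml
  | DiaN prog nfml
and tfml =
    TNot tfml
  | Always bound bound sfml
and nfml =
    AndAlways sfml bound bound sfml
  | OrEventually sfml bound bound sfml

definition Eventually :: "bound \<Rightarrow> bound \<Rightarrow> sfml \<Rightarrow> tfml" where
  "Eventually a b \<phi> = TNot (Always a b (Not \<phi>))"

definition DiaS :: "prog \<Rightarrow> sfml \<Rightarrow> sfml" where
  "DiaS \<alpha> \<phi> = Not (BoxS \<alpha> (Not \<phi>))"

definition DiaT :: "prog \<Rightarrow> tfml \<Rightarrow> sfml" where
  "DiaT \<alpha> \<pi> = Not (BoxT \<alpha> (TNot \<pi>))"

primrec tfml_len :: "tfml \<Rightarrow> bound" where
  "tfml_len (TNot \<pi>) = tfml_len \<pi>"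
| "tfml_len (Always a b \<phi>) = b"

primrec nfml_len :: "nfml \<Rightarrow> bound" where
  "nfml_len (AndAlways \<phi> a b \<psi>) = b"
| "nfml_len (OrEventually \<phi> a b \<psi>) = b"

primrec nfml_sta :: "nfml \<Rightarrow> sfml" where
  "nfml_sta (AndAlways \<phi> a b \<psi>) = \<phi>"
| "nfml_sta (OrEventually \<phi> a b \<psi>) = \<phi>"

lemma size_nfml_sta: "size (nfml_sta \<xi>) < Suc (size \<xi>)"
  by (cases \<xi>) auto


section \<open>Traces\<close>

text \<open>
  \<open>Flow s r f\<close> is the function \<open>f\<close> on \<open>[s, r]\<close>, \<open>FlowInf s f\<close> the function \<open>f\<close> on
  \<open>[s, \<infinity>)\<close>, and \<open>Error s\<close> the error state at time \<open>s\<close>. The values of \<open>f\<close> outside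
  the interval carry no meaning: neither the semantics of programs nor that of formulas looks at
  them.
\<close>

datatype piece =
    Flow real real "real \<Rightarrow> state"
  | FlowInf real "real \<Rightarrow> state"
  | Error real

type_synonym trace = "piece list"

primrec piece_dom :: "piece \<Rightarrow> real set" where
  "piece_dom (Flow s r f) = {s..r}"
| "piece_dom (FlowInf s f) = {s..}"
| "piece_dom (Error s) = {s}"

primrec is_error :: "piece \<Rightarrow> bool" where
  "is_error (Flow s r f) = False"
| "is_error (FlowInf s f) = False"
| "is_error (Error s) = True"

text \<open>The error piece has no state; \<open>state_at\<close> is never applied to it in the semantics.\<close>

primrec state_at :: "piece \<Rightarrow> real \<Rightarrow> state" where
  "state_at (Flow s r f) = f"
| "state_at (FlowInf s f) = f"
| "state_at (Error s) = undefined"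

fun pieces_from :: "real \<Rightarrow> piece list \<Rightarrow> bool" where
  "pieces_from t [Flow s r f] \<longleftrightarrow> s = t \<and> t \<le> r"
| "pieces_from t [FlowInf s f] \<longleftrightarrow> s = t"
| "pieces_from t [Error s] \<longleftrightarrow> s = t"
| "pieces_from t (Flow s r f # p # ps) \<longleftrightarrow> s = t \<and> t \<le> r \<and> pieces_from r (p # ps)"
| "pieces_from t _ \<longleftrightarrow> False"

definition is_trace :: "trace \<Rightarrow> bool" where
  "is_trace \<sigma> \<longleftrightarrow> pieces_from 0 \<sigma> \<and> \<not> is_error (hd \<sigma>)"

definition terminates :: "trace \<Rightarrow> bool" where
  "terminates \<sigma> \<longleftrightarrow> (\<exists>s r f. last \<sigma> = Flow s r f)"

primrec piece_end :: "piece \<Rightarrow> ereal" where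
  "piece_end (Flow s r f) = ereal r"
| "piece_end (FlowInf s f) = \<infinity>"
| "piece_end (Error s) = ereal s"

definition trace_len :: "trace \<Rightarrow> ereal" where
  "trace_len \<sigma> = piece_end (last \<sigma>)"

definition first_state :: "trace \<Rightarrow> state" where
  "first_state \<sigma> = state_at (hd \<sigma>) 0"

text \<open>Meaningful for terminating traces only.\<close>

definition last_state :: "trace \<Rightarrow> state" where
  "last_state \<sigma> = state_at (last \<sigma>) (real_of_ereal (trace_len \<sigma>))"

definition pt :: "state \<Rightarrow> piece" where
  "pt v = Flow 0 0 (\<lambda>_. v)"

primrec shift_piece :: "real \<Rightarrow> piece \<Rightarrow> piece" where
  "shift_piece d (Flow s r f) = Flow (s + d) (r + d) (\<lambda>t. f (t - d))"
| "shift_piece d (FlowInf s f) = FlowInf (s + d) (\<lambda>t. f (t - d))"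
| "shift_piece d (Error s) = Error (s + d)"

definition concat_trace :: "trace \<Rightarrow> trace \<Rightarrow> trace" where
  "concat_trace \<sigma> \<tau> = \<sigma> @ map (shift_piece (real_of_ereal (trace_len \<sigma>))) \<tau>"


section \<open>Semantics of programs\<close>

primrec val :: "state \<Rightarrow> trm \<Rightarrow> real" where
  "val v (Const q) = of_rat q"
| "val v (Var x) = v x"
| "val v (Plus \<theta> \<eta>) = val v \<theta> + val v \<eta>"
| "val v (Times \<theta> \<eta>) = val v \<theta> * val v \<eta>"

primrec fol_sat :: "state \<Rightarrow> fol \<Rightarrow> bool" where
  "fol_sat v (FGeq \<theta> \<eta>) \<longleftrightarrow> val v \<theta> \<ge> val v \<eta>"
| "fol_sat v (FNot \<chi>) \<longleftrightarrow> \<not> fol_sat v \<chi>"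
| "fol_sat v (FAnd \<chi> \<chi>') \<longleftrightarrow> fol_sat v \<chi> \<and> fol_sat v \<chi>'"
| "fol_sat v (FAll x \<chi>) \<longleftrightarrow> (\<forall>d. fol_sat (v(x := d)) \<chi>)"

definition solves_ode :: "(real \<Rightarrow> state) \<Rightarrow> var \<Rightarrow> trm \<Rightarrow> fol \<Rightarrow> real set \<Rightarrow> bool" where
  "solves_ode f x \<theta> \<chi> I \<longleftrightarrow>
     (\<forall>t\<in>I. ((\<lambda>s. f s x) has_real_derivative val (f t) \<theta>) (at t within I)) \<and>
     (\<forall>t\<in>I. \<forall>y. y \<noteq> x \<longrightarrow> f t y = f 0 y) \<and>
     (\<forall>t\<in>I. fol_sat (f t) \<chi>)"

definition seq_traces :: "trace set \<Rightarrow> trace set \<Rightarrow> trace set" where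
  "seq_traces A B =
     {concat_trace \<sigma> \<tau> | \<sigma> \<tau>.
        \<sigma> \<in> A \<and> \<tau> \<in> B \<and> terminates \<sigma> \<and> first_state \<tau> = last_state \<sigma>} \<union>
     {\<sigma> \<in> A. \<not> terminates \<sigma>}"

text \<open>The traces of \<open>?true\<close> are exactly the one-point traces.\<close>

fun rep_traces :: "trace set \<Rightarrow> nat \<Rightarrow> trace set" where
  "rep_traces A 0 = {[pt v] | v. True}"
| "rep_traces A (Suc 0) = A"
| "rep_traces A (Suc (Suc n)) = seq_traces (rep_traces A (Suc n)) A"

primrec traces :: "prog \<Rightarrow> trace set" where
  "traces (Assign x \<theta>) = {[pt v, pt (v(x := val v \<theta>))] | v. True}"
| "traces (Test \<chi>) =
     {[pt v] | v. fol_sat v \<chi>} \<union> {[pt v, Error 0] | v. \<not> fol_sat v \<chi>}"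
| "traces (ODE x \<theta> \<chi>) =
     {[Flow 0 r f] | r f. 0 \<le> r \<and> solves_ode f x \<theta> \<chi> {0..r}} \<union>
     {[FlowInf 0 f] | f. solves_ode f x \<theta> \<chi> {0..}} \<union>
     {[pt v, Error 0] | v. \<not> fol_sat v \<chi>}"
| "traces (Choice \<alpha> \<beta>) = traces \<alpha> \<union> traces \<beta>"
| "traces (Seq \<alpha> \<beta>) = seq_traces (traces \<alpha>) (traces \<beta>)"
| "traces (Loop \<alpha>) = (\<Union>n. rep_traces (traces \<alpha>) n)"

lemma pieces_from_append:
  "pieces_from t \<sigma> \<Longrightarrow> last \<sigma> = Flow s r f \<Longrightarrow> pieces_from r \<tau> \<Longrightarrow> pieces_from t (\<sigma> @ \<tau>)"
proof (induction t \<sigma> rule: pieces_from.induct)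
  case (1 t s' r' f')
  then show ?case by (cases \<tau>) auto
qed auto

lemma pieces_from_shift:
  "pieces_from t \<sigma> \<Longrightarrow> pieces_from (t + d) (map (shift_piece d) \<sigma>)"
  by (induction t \<sigma> rule: pieces_from.induct) auto

lemma pieces_from_nonempty: "pieces_from t \<sigma> \<Longrightarrow> \<sigma> \<noteq> []"
  by auto

lemma seq_traces_is_trace:
  assumes "\<And>\<sigma>. \<sigma> \<in> A \<Longrightarrow> is_trace \<sigma>" and "\<And>\<sigma>. \<sigma> \<in> B \<Longrightarrow> is_trace \<sigma>" and "\<rho> \<in> seq_traces A B"
  shows "is_trace \<rho>"
proof (cases "\<rho> \<in> A")
  case False
  then obtain \<sigma> \<tau> where \<rho>: "\<rho> = concat_trace \<sigma> \<tau>" and \<sigma>: "\<sigma> \<in> A" "terminates \<sigma>" and \<tau>: "\<tau> \<in> B"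
    using assms(3) by (auto simp: seq_traces_def)
  then obtain s r f where l: "last \<sigma> = Flow s r f" by (auto simp: terminates_def)
  have w: "pieces_from 0 \<sigma>" "pieces_from 0 \<tau>" "\<not> is_error (hd \<sigma>)"
    using assms \<sigma> \<tau> by (auto simp: is_trace_def)
  then have "pieces_from 0 \<rho>"
    using pieces_from_append[OF w(1) l] pieces_from_shift[OF w(2), of r] l
    by (simp add: \<rho> concat_trace_def trace_len_def)
  moreover have "hd \<rho> = hd \<sigma>"
    using pieces_from_nonempty[OF w(1)] by (simp add: \<rho> concat_trace_def)
  ultimately show ?thesis using w by (simp add: is_trace_def)
qed (use assms in auto)

lemma rep_traces_is_trace:
  "(\<And>\<sigma>. \<sigma> \<in> A \<Longrightarrow> is_trace \<sigma>) \<Longrightarrow> \<rho> \<in> rep_traces A n \<Longrightarrow> is_trace \<rho>"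
proof (induction A n arbitrary: \<rho> rule: rep_traces.induct)
  case (3 A n)
  show ?case
    by (rule seq_traces_is_trace[OF 3(1)[OF 3(2)] 3(2) 3(3)[unfolded rep_traces.simps]])
qed (auto simp: is_trace_def pt_def)

lemma traces_is_trace: "\<sigma> \<in> traces \<alpha> \<Longrightarrow> is_trace \<sigma>"
proof (induction \<alpha> arbitrary: \<sigma>)
  case (Seq \<alpha> \<beta>)
  show ?case
    by (rule seq_traces_is_trace[OF Seq(1) Seq(2) Seq(3)[unfolded traces.simps]])
next
  case (Loop \<alpha>)
  from Loop(2) obtain n where "\<sigma> \<in> rep_traces (traces \<alpha>) n" by auto
  with Loop(1) show ?case by (rule rep_traces_is_trace)
qed (auto simp: is_trace_def pt_def)


section \<open>Semantics of formulas\<close>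

primrec bval :: "state \<Rightarrow> bound \<Rightarrow> real" where
  "bval v (BTrm \<theta>) = val v \<theta>"
| "bval v (BMax \<theta> \<eta>) = max (val v \<theta>) (val v \<eta>)"
| "bval v (BMin \<theta> \<eta>) = min (val v \<theta>) (val v \<eta>)"
| "bval v (BAdd a b) = bval v a + bval v b"
| "bval v (BSub a b) = bval v a - bval v b"

text \<open>\<open>(\<sigma>,(i,t)) \<Turnstile> \<phi>\<close>, where \<open>P\<close> is the set of states satisfying the state formula \<open>\<phi>\<close>.\<close>

definition holds_at :: "trace \<Rightarrow> nat \<Rightarrow> real \<Rightarrow> (state \<Rightarrow> bool) \<Rightarrow> bool" where
  "holds_at \<sigma> i t P \<longleftrightarrow> trace_len \<sigma> \<ge> ereal t \<and> P (state_at (\<sigma> ! i) t)"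

text \<open>\<open>(\<sigma>,(i,t)) \<Turnstile> \<box>\<^bsub>[a,b]\<^esub>\<phi>\<close>, with \<open>P\<close> as above; the bounds are evaluated in the first state.\<close>

definition always_at :: "trace \<Rightarrow> real \<Rightarrow> bound \<Rightarrow> bound \<Rightarrow> (state \<Rightarrow> bool) \<Rightarrow> bool" where
  "always_at \<sigma> t a b P \<longleftrightarrow>
     (\<forall>t'\<in>{t + bval (first_state \<sigma>) a .. t + bval (first_state \<sigma>) b}. \<forall>i<length \<sigma>.
        t' \<in> piece_dom (\<sigma> ! i) \<and> \<not> is_error (\<sigma> ! i) \<longrightarrow> holds_at \<sigma> i t' P)"

text \<open>\<open>sat v \<phi>\<close> is \<open>v \<Turnstile> \<phi>\<close>, \<open>tsat \<sigma> i t \<pi>\<close> is \<open>(\<sigma>,(i,t)) \<Turnstile> \<pi>\<close>, and \<open>nsat \<sigma> \<xi>\<close> is \<open>\<sigma> \<Turnstile> \<xi>\<close>.\<close>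

function sat :: "state \<Rightarrow> sfml \<Rightarrow> bool"
  and tsat :: "trace \<Rightarrow> nat \<Rightarrow> real \<Rightarrow> tfml \<Rightarrow> bool"
  and nsat :: "trace \<Rightarrow> nfml \<Rightarrow> bool" where
  "sat v (Geq \<theta> \<eta>) \<longleftrightarrow> val v \<theta> \<ge> val v \<eta>"
| "sat v (Not \<phi>) \<longleftrightarrow> \<not> sat v \<phi>"
| "sat v (And \<phi> \<psi>) \<longleftrightarrow> sat v \<phi> \<and> sat v \<psi>"
| "sat v (All x \<phi>) \<longleftrightarrow> (\<forall>d. sat (v(x := d)) \<phi>)"
| "sat v (BoxS \<alpha> \<phi>) \<longleftrightarrow>
     (\<forall>\<sigma>\<in>traces \<alpha>. first_state \<sigma> = v \<and> terminates \<sigma> \<longrightarrow> sat (last_state \<sigma>) \<phi>)"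
| "sat v (BoxT \<alpha> \<pi>) \<longleftrightarrow>
     (\<forall>\<sigma>\<in>traces \<alpha>. first_state \<sigma> = v \<and> trace_len \<sigma> \<ge> ereal (bval v (tfml_len \<pi>)) \<longrightarrow>
        tsat \<sigma> 0 0 \<pi>)"
| "sat v (BoxN \<alpha> \<xi>) \<longleftrightarrow>
     (\<forall>\<sigma>\<in>traces \<alpha>. first_state \<sigma> = v \<longrightarrow>
        (terminates \<sigma> \<longrightarrow> sat (last_state \<sigma>) (nfml_sta \<xi>)) \<and>
        (trace_len \<sigma> \<ge> ereal (bval v (nfml_len \<xi>)) \<longrightarrow> nsat \<sigma> \<xi>))"
| "sat v (DiaN \<alpha> \<xi>) \<longleftrightarrow>
     (\<exists>\<sigma>\<in>traces \<alpha>. first_state \<sigma> = v \<and>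
        (terminates \<sigma> \<longrightarrow> sat (last_state \<sigma>) (nfml_sta \<xi>)) \<and>
        trace_len \<sigma> \<ge> ereal (bval v (nfml_len \<xi>)) \<and> nsat \<sigma> \<xi>)"
| "tsat \<sigma> i t (TNot \<pi>) \<longleftrightarrow> \<not> tsat \<sigma> i t \<pi>"
| "tsat \<sigma> i t (Always a b \<phi>) \<longleftrightarrow> always_at \<sigma> t a b (\<lambda>w. sat w \<phi>)"
| "nsat \<sigma> (AndAlways \<phi> a b \<psi>) \<longleftrightarrow>
     (if terminates \<sigma> then sat (last_state \<sigma>) \<phi> \<and> always_at \<sigma> 0 a b (\<lambda>w. sat w \<psi>)
      else always_at \<sigma> 0 a b (\<lambda>w. sat w \<psi>))"
| "nsat \<sigma> (OrEventually \<phi> a b \<psi>) \<longleftrightarrow>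
     (if terminates \<sigma> then sat (last_state \<sigma>) \<phi> \<or> \<not> always_at \<sigma> 0 a b (\<lambda>w. \<not> sat w \<psi>)
      else \<not> always_at \<sigma> 0 a b (\<lambda>w. \<not> sat w \<psi>))"
  by pat_completeness auto
termination
  by (relation "measure (\<lambda>x. case x of Inl (v, \<phi>) \<Rightarrow> size \<phi>
    | Inr (Inl (\<sigma>, i, t, \<pi>)) \<Rightarrow> size \<pi> | Inr (Inr (\<sigma>, \<xi>)) \<Rightarrow> size \<xi>)")
    (auto simp: size_nfml_sta)

lemma nsat_AndAlways:
  "nsat \<sigma> (AndAlways \<phi> a b \<psi>) \<longleftrightarrow>
     (if terminates \<sigma> then sat (last_state \<sigma>) \<phi> \<and> tsat \<sigma> 0 0 (Always a b \<psi>)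
      else tsat \<sigma> 0 0 (Always a b \<psi>))"
  by simp

lemma nsat_OrEventually:
  "nsat \<sigma> (OrEventually \<phi> a b \<psi>) \<longleftrightarrow>
     (if terminates \<sigma> then sat (last_state \<sigma>) \<phi> \<or> tsat \<sigma> 0 0 (Eventually a b \<psi>)
      else tsat \<sigma> 0 0 (Eventually a b \<psi>))"
  by (simp add: Eventually_def)

definition valid :: "sfml \<Rightarrow> bool" where
  "valid \<phi> \<longleftrightarrow> (\<forall>v. sat v \<phi>)"


section \<open>Goedel numbering\<close>

primrec code_trm :: "trm \<Rightarrow> nat" where
  "code_trm (Const q) =
     list_encode [0, int_encode (fst (quotient_of q)), int_encode (snd (quotient_of q))]"
| "code_trm (Var x) = list_encode [1, x]"
| "code_trm (Plus \<theta> \<eta>) = list_encode [2, code_trm \<theta>, code_trm \<eta>]"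
| "code_trm (Times \<theta> \<eta>) = list_encode [3, code_trm \<theta>, code_trm \<eta>]"

primrec code_fol :: "fol \<Rightarrow> nat" where
  "code_fol (FGeq \<theta> \<eta>) = list_encode [0, code_trm \<theta>, code_trm \<eta>]"
| "code_fol (FNot \<chi>) = list_encode [1, code_fol \<chi>]"
| "code_fol (FAnd \<chi> \<chi>') = list_encode [2, code_fol \<chi>, code_fol \<chi>']"
| "code_fol (FAll x \<chi>) = list_encode [3, x, code_fol \<chi>]"

primrec code_prog :: "prog \<Rightarrow> nat" where
  "code_prog (Assign x \<theta>) = list_encode [0, x, code_trm \<theta>]"
| "code_prog (Test \<chi>) = list_encode [1, code_fol \<chi>]"
| "code_prog (ODE x \<theta> \<chi>) = list_encode [2, x, code_trm \<theta>, code_fol \<chi>]"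
| "code_prog (Choice \<alpha> \<beta>) = list_encode [3, code_prog \<alpha>, code_prog \<beta>]"
| "code_prog (Seq \<alpha> \<beta>) = list_encode [4, code_prog \<alpha>, code_prog \<beta>]"
| "code_prog (Loop \<alpha>) = list_encode [5, code_prog \<alpha>]"

primrec code_bound :: "bound \<Rightarrow> nat" where
  "code_bound (BTrm \<theta>) = list_encode [0, code_trm \<theta>]"
| "code_bound (BMax \<theta> \<eta>) = list_encode [1, code_trm \<theta>, code_trm \<eta>]"
| "code_bound (BMin \<theta> \<eta>) = list_encode [2, code_trm \<theta>, code_trm \<eta>]"
| "code_bound (BAdd a b) = list_encode [3, code_bound a, code_bound b]"
| "code_bound (BSub a b) = list_encode [4, code_bound a, code_bound b]"

primrec code_sfml :: "sfml \<Rightarrow> nat"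
  and code_tfml :: "tfml \<Rightarrow> nat"
  and code_nfml :: "nfml \<Rightarrow> nat" where
  "code_sfml (Geq \<theta> \<eta>) = list_encode [0, code_trm \<theta>, code_trm \<eta>]"
| "code_sfml (Not \<phi>) = list_encode [1, code_sfml \<phi>]"
| "code_sfml (And \<phi> \<psi>) = list_encode [2, code_sfml \<phi>, code_sfml \<psi>]"
| "code_sfml (All x \<phi>) = list_encode [3, x, code_sfml \<phi>]"
| "code_sfml (BoxS \<alpha> \<phi>) = list_encode [4, code_prog \<alpha>, code_sfml \<phi>]"
| "code_sfml (BoxT \<alpha> \<pi>) = list_encode [5, code_prog \<alpha>, code_tfml \<pi>]"
| "code_sfml (BoxN \<alpha> \<xi>) = list_encode [6, code_prog \<alpha>, code_nfml \<xi>]"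
| "code_sfml (DiaN \<alpha> \<xi>) = list_encode [7, code_prog \<alpha>, code_nfml \<xi>]"
| "code_tfml (TNot \<pi>) = list_encode [0, code_tfml \<pi>]"
| "code_tfml (Always a b \<phi>) = list_encode [1, code_bound a, code_bound b, code_sfml \<phi>]"
| "code_nfml (AndAlways \<phi> a b \<psi>) =
     list_encode [0, code_sfml \<phi>, code_bound a, code_bound b, code_sfml \<psi>]"
| "code_nfml (OrEventually \<phi> a b \<psi>) =
     list_encode [1, code_sfml \<phi>, code_bound a, code_bound b, code_sfml \<psi>]"

lemma code_trm_inj: "code_trm \<theta> = code_trm \<eta> \<Longrightarrow> \<theta> = \<eta>"
proof (induction \<theta> arbitrary: \<eta>)
  case (Const q)
  then show ?case
    by (cases \<eta>) (auto simp: list_encode_eq int_encode_eq intro: quotient_of_inject prod_eqI)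
next
  case (Var x) then show ?case by (cases \<eta>) (auto simp: list_encode_eq)
next
  case (Plus \<theta>1 \<theta>2) then show ?case by (cases \<eta>) (auto simp: list_encode_eq)
next
  case (Times \<theta>1 \<theta>2) then show ?case by (cases \<eta>) (auto simp: list_encode_eq)
qed

lemma code_fol_inj: "code_fol \<chi> = code_fol \<chi>' \<Longrightarrow> \<chi> = \<chi>'"
proof (induction \<chi> arbitrary: \<chi>')
qed (case_tac \<chi>'; auto simp: list_encode_eq dest: code_trm_inj)+

lemma code_prog_inj: "code_prog \<alpha> = code_prog \<beta> \<Longrightarrow> \<alpha> = \<beta>"
proof (induction \<alpha> arbitrary: \<beta>)
qed (case_tac \<beta>; auto simp: list_encode_eq dest: code_trm_inj code_fol_inj)+

lemma code_bound_inj: "code_bound a = code_bound b \<Longrightarrow> a = b"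
proof (induction a arbitrary: b)
qed (case_tac b; auto simp: list_encode_eq dest: code_trm_inj)+

lemma code_fml_inj:
  "code_sfml \<phi> = code_sfml \<phi>' \<Longrightarrow> \<phi> = \<phi>'"
  "code_tfml \<pi> = code_tfml \<pi>' \<Longrightarrow> \<pi> = \<pi>'"
  "code_nfml \<xi> = code_nfml \<xi>' \<Longrightarrow> \<xi> = \<xi>'"
proof (induction \<phi> and \<pi> and \<xi> arbitrary: \<phi>' and \<pi>' and \<xi>')
  case Geq
  then show ?case by (cases \<phi>') (auto simp: list_encode_eq dest: code_trm_inj code_prog_inj code_bound_inj)
next
  case Not
  then show ?case by (cases \<phi>') (auto simp: list_encode_eq dest: code_trm_inj code_prog_inj code_bound_inj)
next
  case And
  then show ?case by (cases \<phi>') (auto simp: list_encode_eq dest: code_trm_inj code_prog_inj code_bound_inj)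
next
  case All
  then show ?case by (cases \<phi>') (auto simp: list_encode_eq dest: code_trm_inj code_prog_inj code_bound_inj)
next
  case BoxS
  then show ?case by (cases \<phi>') (auto simp: list_encode_eq dest: code_trm_inj code_prog_inj code_bound_inj)
next
  case BoxT
  then show ?case by (cases \<phi>') (auto simp: list_encode_eq dest: code_trm_inj code_prog_inj code_bound_inj)
next
  case BoxN
  then show ?case by (cases \<phi>') (auto simp: list_encode_eq dest: code_trm_inj code_prog_inj code_bound_inj)
next
  case DiaN
  then show ?case by (cases \<phi>') (auto simp: list_encode_eq dest: code_trm_inj code_prog_inj code_bound_inj)
next
  case TNot
  then show ?case by (cases \<pi>') (auto simp: list_encode_eq dest: code_trm_inj code_prog_inj code_bound_inj)
next
  case Always
  then show ?case by (cases \<pi>') (auto simp: list_encode_eq dest: code_trm_inj code_prog_inj code_bound_inj)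
next
  case AndAlways
  then show ?case by (cases \<xi>') (auto simp: list_encode_eq dest: code_trm_inj code_prog_inj code_bound_inj)
next
  case OrEventually
  then show ?case by (cases \<xi>') (auto simp: list_encode_eq dest: code_trm_inj code_prog_inj code_bound_inj)
qed


section \<open>Effective proof calculi\<close>

text \<open>
  The total recursive functions: the closure of zero, successor and the projections under
  composition, primitive recursion and minimisation of regular functions. An \<open>n\<close>-ary function is
  represented on argument lists of length \<open>n\<close>; in primitive recursion and minimisation the first
  argument is the recursion, respectively search, argument.
\<close>

inductive recursive :: "nat \<Rightarrow> (nat list \<Rightarrow> nat) \<Rightarrow> bool" where
  zero: "recursive n (\<lambda>_. 0)"
| succ: "recursive 1 (\<lambda>xs. Suc (xs ! 0))"
| proj: "i < n \<Longrightarrow> recursive n (\<lambda>xs. xs ! i)"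
| comp: "\<lbrakk>recursive (length gs) f; \<And>g. g \<in> set gs \<Longrightarrow> recursive n g\<rbrakk>
    \<Longrightarrow> recursive n (\<lambda>xs. f (map (\<lambda>g. g xs) gs))"
| prim: "\<lbrakk>recursive n f; recursive (Suc (Suc n)) g\<rbrakk>
    \<Longrightarrow> recursive (Suc n) (\<lambda>xs. rec_nat (f (tl xs)) (\<lambda>k y. g (k # y # tl xs)) (hd xs))"
| mini: "\<lbrakk>recursive (Suc n) f; \<And>xs. length xs = n \<Longrightarrow> \<exists>k. f (k # xs) = 0\<rbrakk>
    \<Longrightarrow> recursive n (\<lambda>xs. LEAST k. f (k # xs) = 0)"

text \<open>
  Proofs are finite syntactic objects and are therefore identified with their numbers: a calculus
  is the relation ``\<open>p\<close> is (the number of) a proof of \<open>\<phi>\<close>''. Nothing is assumed about the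
  internal structure of proofs, so Hilbert, sequent, tableau and other calculi, possibly with
  auxiliary syntax or data, are all covered. The calculus is effective if an algorithm decides
  whether a given \<open>p\<close> is a proof of a given \<open>\<phi>\<close>.
\<close>

type_synonym calculus = "nat \<Rightarrow> sfml \<Rightarrow> bool"

definition effective :: "calculus \<Rightarrow> bool" where
  "effective C \<longleftrightarrow>
     (\<exists>f. recursive 2 f \<and> (\<forall>p \<phi>. f [p, code_sfml \<phi>] = (if C p \<phi> then 1 else 0)))"

definition provable :: "calculus \<Rightarrow> sfml \<Rightarrow> bool" where
  "provable C \<phi> \<longleftrightarrow> (\<exists>p. C p \<phi>)"

definition sound :: "calculus \<Rightarrow> bool" where
  "sound C \<longleftrightarrow> (\<forall>\<phi>. provable C \<phi> \<longrightarrow> valid \<phi>)"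

definition complete :: "calculus \<Rightarrow> bool" where
  "complete C \<longleftrightarrow> (\<forall>\<phi>. valid \<phi> \<longrightarrow> provable C \<phi>)"

end

theory Submission
  imports Defs
begin

text \<open>
  Tests, assignments and loops suffice to simulate every recursive function on natural-valued
  variables, so nonprovability of the formula with a given number is expressible by a formula.
  Diagonalisation needs no substitution function: the self-application of a formula \<open>A\<close> with free
  variable \<open>x\<^sub>0\<close> is \<open>[x\<^sub>0 := n]A\<close> with \<open>n\<close> the number of \<open>A\<close>. Since \<open>list_encode\<close> is built from
  triangular numbers, the number of this formula is a polynomial in \<open>n\<close> with rational coefficients
  and thus the value of a term.
\<close>

section \<open>Input-output relations of programs\<close>

text \<open>The modality \<open>BoxS\<close> sees only the end points of terminating traces, so this
  relation is all that the reduction needs from the trace semantics; durations, error traces and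
  infinite traces drop out.\<close>

definition rel :: "trace set \<Rightarrow> state \<Rightarrow> state \<Rightarrow> bool" where
  "rel A v w \<longleftrightarrow> (\<exists>\<sigma>\<in>A. terminates \<sigma> \<and> first_state \<sigma> = v \<and> last_state \<sigma> = w)"

lemma sat_BoxS_rel: "sat v (BoxS \<alpha> \<phi>) \<longleftrightarrow> (\<forall>w. rel (traces \<alpha>) v w \<longrightarrow> sat w \<phi>)"
  by (auto simp: rel_def)

text \<open>Shifting keeps the kind of a piece and moves its end time and the argument of its flow
  by the same amount, so the two shifts cancel in the last state. Being traces ensures that both
  lists are nonempty.\<close>

lemma concat_trace_terminating:
  assumes "is_trace \<sigma>" "is_trace \<tau>"
  shows "terminates (concat_trace \<sigma> \<tau>) \<longleftrightarrow> terminates \<tau>"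
    and "first_state (concat_trace \<sigma> \<tau>) = first_state \<sigma>"
    and "terminates \<tau> \<Longrightarrow> last_state (concat_trace \<sigma> \<tau>) = last_state \<tau>"
proof -
  have ne: "\<sigma> \<noteq> []" "\<tau> \<noteq> []"
    using assms by (auto simp: is_trace_def dest: pieces_from_nonempty)
  define d where "d = real_of_ereal (trace_len \<sigma>)"
  have l: "last (concat_trace \<sigma> \<tau>) = shift_piece d (last \<tau>)"
    using ne by (simp add: concat_trace_def d_def last_map)
  show "terminates (concat_trace \<sigma> \<tau>) \<longleftrightarrow> terminates \<tau>"
    unfolding terminates_def l by (cases "last \<tau>") auto
  show "first_state (concat_trace \<sigma> \<tau>) = first_state \<sigma>"
    using ne by (simp add: first_state_def concat_trace_def)
  show "last_state (concat_trace \<sigma> \<tau>) = last_state \<tau>" if "terminates \<tau>"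
    using that by (auto simp: last_state_def trace_len_def terminates_def l)
qed

lemma rel_seq_traces:
  assumes "\<And>\<sigma>. \<sigma> \<in> A \<Longrightarrow> is_trace \<sigma>" and "\<And>\<sigma>. \<sigma> \<in> B \<Longrightarrow> is_trace \<sigma>"
  shows "rel (seq_traces A B) = rel A OO rel B"
proof (intro ext iffI)
  fix v w
  assume "rel (seq_traces A B) v w"
  then obtain \<sigma> \<tau> where "\<sigma> \<in> A" "terminates \<sigma>" "\<tau> \<in> B" "first_state \<tau> = last_state \<sigma>"
    "terminates (concat_trace \<sigma> \<tau>)" "first_state (concat_trace \<sigma> \<tau>) = v"
    "last_state (concat_trace \<sigma> \<tau>) = w"
    unfolding rel_def seq_traces_def by blast
  with assms concat_trace_terminating[of \<sigma> \<tau>] have "rel A v (last_state \<sigma>)" "rel B (last_state \<sigma>) w"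
    by (auto simp: rel_def)
  then show "(rel A OO rel B) v w" by blast
next
  fix v w
  assume "(rel A OO rel B) v w"
  then obtain \<sigma> \<tau> where "\<sigma> \<in> A" "terminates \<sigma>" "first_state \<sigma> = v" "\<tau> \<in> B" "terminates \<tau>"
    "first_state \<tau> = last_state \<sigma>" "last_state \<tau> = w"
    by (auto simp: rel_def)
  moreover from this have "concat_trace \<sigma> \<tau> \<in> seq_traces A B"
    by (auto simp: seq_traces_def)
  ultimately show "rel (seq_traces A B) v w"
    using assms concat_trace_terminating[of \<sigma> \<tau>] unfolding rel_def by blast
qed

lemma rel_one_point: "rel {[pt v] | v. P v} v w \<longleftrightarrow> w = v \<and> P v"
  by (auto simp: rel_def terminates_def first_state_def last_state_def trace_len_def pt_def)

text \<open>A single pass is a separate case of \<open>rep_traces\<close>, without a leading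
  one-point piece. The relations do not notice the difference, since equality is a unit of
  composition.\<close>

lemma rel_rep_traces:
  "(\<And>\<sigma>. \<sigma> \<in> A \<Longrightarrow> is_trace \<sigma>) \<Longrightarrow> rel (rep_traces A n) = rel A ^^ n"
proof (induction A n rule: rep_traces.induct)
  case (1 A)
  show ?case by (intro ext) (use rel_one_point[of "\<lambda>_. True"] in auto)
next
  case (3 A n)
  have "rel (rep_traces A (Suc (Suc n))) = rel (rep_traces A (Suc n)) OO rel A"
    by (simp add: rel_seq_traces rep_traces_is_trace[OF 3(2)] 3(2))
  with 3 show ?case by simp
qed (simp add: eq_OO)

lemma rel_Assign: "rel (traces (Assign x \<theta>)) v w \<longleftrightarrow> w = v(x := val v \<theta>)"
  by (auto simp: rel_def terminates_def first_state_def last_state_def trace_len_def pt_def)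

lemma rel_Test: "rel (traces (Test \<chi>)) v w \<longleftrightarrow> w = v \<and> fol_sat v \<chi>"
proof -
  \<comment> \<open>A failed test ends in the error piece and hence does not terminate.\<close>
  have "rel (traces (Test \<chi>)) v w \<longleftrightarrow> rel {[pt v] | v. fol_sat v \<chi>} v w"
    by (fastforce simp: rel_def terminates_def)
  then show ?thesis unfolding rel_one_point .
qed

lemma rel_Seq: "rel (traces (Seq \<alpha> \<beta>)) = rel (traces \<alpha>) OO rel (traces \<beta>)"
  by (simp add: rel_seq_traces traces_is_trace)

lemma rel_Loop: "rel (traces (Loop \<alpha>)) = (rel (traces \<alpha>))\<^sup>*\<^sup>*"
proof (intro ext)
  fix v w
  have "rel (traces (Loop \<alpha>)) v w \<longleftrightarrow> (\<exists>n. rel (rep_traces (traces \<alpha>) n) v w)"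
    by (auto simp: rel_def)
  also have "\<dots> \<longleftrightarrow> (rel (traces \<alpha>))\<^sup>*\<^sup>* v w"
    by (simp add: rel_rep_traces traces_is_trace rtranclp_power)
  finally show "rel (traces (Loop \<alpha>)) v w \<longleftrightarrow> (rel (traces \<alpha>))\<^sup>*\<^sup>* v w" .
qed

section \<open>Total correctness of while programs\<close>

definition correct :: "prog \<Rightarrow> state \<Rightarrow> (state \<Rightarrow> bool) \<Rightarrow> bool" where
  "correct \<alpha> v Q \<longleftrightarrow> (\<exists>w. rel (traces \<alpha>) v w) \<and> (\<forall>w. rel (traces \<alpha>) v w \<longrightarrow> Q w)"

lemma correct_mono: "correct \<alpha> v P \<Longrightarrow> (\<And>w. P w \<Longrightarrow> Q w) \<Longrightarrow> correct \<alpha> v Q"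
  by (auto simp: correct_def)

lemma correct_Assign: "Q (v(x := val v \<theta>)) \<Longrightarrow> correct (Assign x \<theta>) v Q"
  by (simp add: correct_def rel_Assign del: traces.simps)

lemma correct_Seq: "correct \<alpha> v (\<lambda>u. correct \<beta> u Q) \<Longrightarrow> correct (Seq \<alpha> \<beta>) v Q"
  by (auto simp: correct_def rel_Seq simp del: traces.simps) blast

definition while :: "fol \<Rightarrow> prog \<Rightarrow> prog" where
  "while \<chi> \<alpha> = Seq (Loop (Seq (Test \<chi>) \<alpha>)) (Test (FNot \<chi>))"

text \<open>The star chooses the number of passes freely, and the tests discard every choice but
  \<open>N\<close>: before \<open>N\<close> passes the guard is true and blocks the exit, after
  \<open>N\<close> passes it is false and blocks another pass. Thus \<open>inv\<close> bounds the
  index of every reachable state, while \<open>reach\<close> supplies a run that really gets to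
  \<open>N\<close>.\<close>

lemma correct_while:
  assumes init: "I 0 v"
    and step: "\<And>k u. k < N \<Longrightarrow> I k u \<Longrightarrow> fol_sat u \<chi> \<and> correct \<alpha> u (I (Suc k))"
    and exit: "\<And>u. I N u \<Longrightarrow> \<not> fol_sat u \<chi>"
  shows "correct (while \<chi> \<alpha>) v (I N)"
proof -
  let ?R = "\<lambda>u w. fol_sat u \<chi> \<and> rel (traces \<alpha>) u w"
  have body: "rel (traces (Seq (Test \<chi>) \<alpha>)) = ?R"
    by (intro ext) (auto simp: rel_Seq rel_Test OO_def simp del: traces.simps)
  have rel_while: "rel (traces (while \<chi> \<alpha>)) v w \<longleftrightarrow> ?R\<^sup>*\<^sup>* v w \<and> \<not> fol_sat w \<chi>" for w
    by (auto simp: while_def rel_Seq[of "Loop _"] rel_Loop rel_Test OO_def body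
        simp del: traces.simps)
  have inv: "\<exists>k\<le>N. I k u" if "?R\<^sup>*\<^sup>* v u" for u
    using that
  proof induction
    case base
    show ?case using init by blast
  next
    case (step u w)
    then obtain k where k: "k \<le> N" "I k u" by blast
    with step exit have "k < N" by (metis le_neq_implies_less)
    with k step assms(2)[of k u] show ?case by (auto simp: correct_def intro!: exI[of _ "Suc k"])
  qed
  have reach: "\<exists>u. ?R\<^sup>*\<^sup>* v u \<and> I k u" if "k \<le> N" for k
    using that
  proof (induction k)
    case 0
    show ?case using init by blast
  next
    case (Suc k)
    then obtain u where u: "?R\<^sup>*\<^sup>* v u" "I k u" by auto
    with step[of k u] Suc.prems obtain w where "?R u w" "I (Suc k) w"
      by (auto simp: correct_def)
    with rtranclp.rtrancl_into_rtrancl[OF u(1), of w] show ?case by blast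
  qed
  show ?thesis
    unfolding correct_def rel_while
  proof (intro conjI allI impI)
    show "\<exists>w. ?R\<^sup>*\<^sup>* v w \<and> \<not> fol_sat w \<chi>" using reach[of N] exit by auto
    fix w
    assume w: "?R\<^sup>*\<^sup>* v w \<and> \<not> fol_sat w \<chi>"
    then obtain k where "k \<le> N" "I k w" using inv by blast
    with w step show "I N w" by (metis le_neq_implies_less)
  qed
qed

section \<open>Recursive functions are computed by programs\<close>

text \<open>
  The variables above the output variable \<open>b\<close> are working space, which the program may overwrite.
\<close>

definition computes :: "prog \<Rightarrow> var list \<Rightarrow> var \<Rightarrow> (nat list \<Rightarrow> nat) \<Rightarrow> bool" where
  "computes \<alpha> is b f \<longleftrightarrow>
     (\<forall>v xs. map v is = map real xs \<longrightarrow>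
        correct \<alpha> v (\<lambda>w. w b = real (f xs) \<and> (\<forall>y<b. w y = v y)))"

text \<open>Input and output variables are arbitrary so that programs can be composed wherever their
  arguments happen to lie. As inputs lie below \<open>b\<close>, they survive the run and can be
  read again.\<close>

definition computable :: "nat \<Rightarrow> (nat list \<Rightarrow> nat) \<Rightarrow> bool" where
  "computable n f \<longleftrightarrow> (\<forall>is b. length is = n \<and> (\<forall>i\<in>set is. i < b) \<longrightarrow> (\<exists>\<alpha>. computes \<alpha> is b f))"

lemma computesD:
  "computes \<alpha> is b f \<Longrightarrow> map v is = map real xs \<Longrightarrow>
    (\<And>w. w b = real (f xs) \<Longrightarrow> \<forall>y<b. w y = v y \<Longrightarrow> Q w) \<Longrightarrow> correct \<alpha> v Q"
  by (rule correct_mono[where P = "\<lambda>w. w b = real (f xs) \<and> (\<forall>y<b. w y = v y)"])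
    (simp_all add: computes_def)

lemma map_agree: "map v is = xs \<Longrightarrow> \<forall>y<b. w y = v y \<Longrightarrow> \<forall>i\<in>set is. i < b \<Longrightarrow> map w is = xs"
  by auto

lemma computes_Assign:
  assumes "\<And>v xs. map v is = map real xs \<Longrightarrow> val v \<theta> = real (f xs)"
  shows "computes (Assign b \<theta>) is b f"
  unfolding computes_def by (auto intro!: correct_Assign simp: assms)

text \<open>The output variable moves up by one for each function, which protects the inputs and all
  earlier results from later programs.\<close>

lemma computable_tuple:
  assumes "\<And>g. g \<in> set gs \<Longrightarrow> computable (length is) g" and "\<forall>i\<in>set is. i < b"
  shows "\<exists>\<alpha>. \<forall>v xs. map v is = map real xs \<longrightarrow>
    correct \<alpha> v (\<lambda>w. map w [b..<b + length gs] = map (\<lambda>g. real (g xs)) gs \<and> (\<forall>y<b. w y = v y))"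
  using assms(1)
proof (induction gs rule: rev_induct)
  case Nil
  \<comment> \<open>The assignment to the scratch variable \<open>b\<close> acts as a skip.\<close>
  show ?case by (auto intro!: exI[of _ "Assign b (Const 0)"] correct_Assign)
next
  case (snoc g gs)
  let ?b = "b + length gs"
  from snoc obtain \<alpha> where \<alpha>: "\<And>v xs. map v is = map real xs \<Longrightarrow>
    correct \<alpha> v (\<lambda>w. map w [b..<?b] = map (\<lambda>g. real (g xs)) gs \<and> (\<forall>y<b. w y = v y))"
    by auto
  have "computable (length is) g" using snoc.prems by simp
  moreover have "\<forall>i\<in>set is. i < ?b" using assms(2) by auto
  ultimately obtain \<beta> where \<beta>: "computes \<beta> is ?b g" unfolding computable_def by blast
  show ?case
  proof (intro exI allI impI)
    fix v xs
    assume v: "map v is = map real xs"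
    show "correct (Seq \<alpha> \<beta>) v (\<lambda>w. map w [b..<b + length (gs @ [g])] =
      map (\<lambda>g. real (g xs)) (gs @ [g]) \<and> (\<forall>y<b. w y = v y))"
    proof (rule correct_Seq, rule correct_mono[OF \<alpha>[OF v]], elim conjE)
      fix u
      assume u: "map u [b..<?b] = map (\<lambda>g. real (g xs)) gs" "\<forall>y<b. u y = v y"
      show "correct \<beta> u (\<lambda>w. map w [b..<b + length (gs @ [g])] =
        map (\<lambda>g. real (g xs)) (gs @ [g]) \<and> (\<forall>y<b. w y = v y))"
      proof (rule computesD[OF \<beta> map_agree[OF v u(2) assms(2)]])
        fix w
        assume w: "w ?b = real (g xs)" "\<forall>y<?b. w y = u y"
        then have "map w [b..<?b] = map (\<lambda>g. real (g xs)) gs"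
          using u(1) by (intro map_agree[OF u(1) w(2)]) auto
        with u w show "map w [b..<b + length (gs @ [g])] =
          map (\<lambda>g. real (g xs)) (gs @ [g]) \<and> (\<forall>y<b. w y = v y)" by simp
      qed
    qed
  qed
qed

section \<open>Closure under composition, primitive recursion and minimisation\<close>

lemma computable_comp:
  assumes f: "computable (length gs) f" and gs: "\<And>g. g \<in> set gs \<Longrightarrow> computable n g"
  shows "computable n (\<lambda>xs. f (map (\<lambda>g. g xs) gs))"
  unfolding computable_def
proof (intro allI impI, elim conjE)
  fix "is" :: "var list" and b
  assume n: "length is = n" and b: "\<forall>i\<in>set is. i < b"
  let ?b = "b + length gs"
  obtain \<alpha> where \<alpha>: "\<And>v xs. map v is = map real xs \<Longrightarrow>
    correct \<alpha> v (\<lambda>w. map w [b..<?b] = map (\<lambda>g. real (g xs)) gs \<and> (\<forall>y<b. w y = v y))"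
    using computable_tuple[OF _ b, of gs] gs n by auto
  obtain \<beta> where \<beta>: "computes \<beta> [b..<?b] ?b f"
    using f unfolding computable_def by (metis atLeastLessThan_iff diff_add_inverse length_upt set_upt)
  show "\<exists>\<alpha>. computes \<alpha> is b (\<lambda>xs. f (map (\<lambda>g. g xs) gs))"
    unfolding computes_def
  proof (intro exI allI impI)
    fix v xs
    assume v: "map v is = map real xs"
    show "correct (Seq \<alpha> (Seq \<beta> (Assign b (Var ?b)))) v
      (\<lambda>w. w b = real (f (map (\<lambda>g. g xs) gs)) \<and> (\<forall>y<b. w y = v y))"
    proof (rule correct_Seq, rule correct_mono[OF \<alpha>[OF v]], rule correct_Seq, elim conjE)
      fix u
      assume u: "map u [b..<?b] = map (\<lambda>g. real (g xs)) gs" "\<forall>y<b. u y = v y"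
      then have "map u [b..<?b] = map real (map (\<lambda>g. g xs) gs)" by (simp add: comp_def)
      with u(2) show "correct \<beta> u (\<lambda>u. correct (Assign b (Var ?b)) u
        (\<lambda>w. w b = real (f (map (\<lambda>g. g xs) gs)) \<and> (\<forall>y<b. w y = v y)))"
        by (auto intro!: computesD[OF \<beta>] correct_Assign)
    qed
  qed
qed

text \<open>Variable \<open>b\<close> holds the current value and \<open>b + 1\<close> the counter,
  while \<open>b + 2\<close> receives the output of \<open>g\<close> before it is copied to
  \<open>b\<close>. The loop runs until the counter reaches the recursion argument in
  \<open>i\<close>.\<close>

lemma computable_prim:
  assumes f: "computable n f" and g: "computable (Suc (Suc n)) g"
  shows "computable (Suc n)
    (\<lambda>xs. rec_nat (f (tl xs)) (\<lambda>k y. g (k # y # tl xs)) (hd xs))"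
  unfolding computable_def
proof (intro allI impI, elim conjE)
  fix js :: "var list" and b
  assume "length js = Suc n" and js: "\<forall>i\<in>set js. i < b"
  then obtain i "is" where js_eq: "js = i # is" and n: "length is = n" by (cases js) auto
  with js have i: "i < b" and b: "\<forall>j\<in>set is. j < b" by auto
  from f n b obtain \<alpha> where \<alpha>: "computes \<alpha> is b f" unfolding computable_def by blast
  have "\<forall>j\<in>set (Suc b # b # is). j < b + 2" using b by auto
  with g n obtain \<beta> where \<beta>: "computes \<beta> (Suc b # b # is) (b + 2) g"
    unfolding computable_def by (metis length_Cons)
  let ?body = "Seq \<beta> (Seq (Assign b (Var (b + 2))) (Assign (Suc b) (Plus (Var (Suc b)) (Const 1))))"
  let ?\<chi> = "FNot (FGeq (Var (Suc b)) (Var i))"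
  show "\<exists>\<alpha>. computes \<alpha> js b (\<lambda>xs. rec_nat (f (tl xs)) (\<lambda>k y. g (k # y # tl xs)) (hd xs))"
    unfolding computes_def
  proof (intro exI allI impI)
    fix v :: state and ys :: "nat list"
    assume "map v js = map real ys"
    then obtain x xs where ys: "ys = x # xs" and x: "v i = real x" and v: "map v is = map real xs"
      by (cases ys) (auto simp: js_eq)
    define h where "h = rec_nat (f xs) (\<lambda>k y. g (k # y # xs))"
    have h: "h 0 = f xs" "h (Suc k) = g (k # h k # xs)" for k by (simp_all add: h_def)
    define I where "I k w \<longleftrightarrow> w b = real (h k) \<and> w (Suc b) = real k \<and> (\<forall>y<b. w y = v y)"
      for k and w :: state
    have "correct (while ?\<chi> ?body) u (I x)" if "I 0 u" for u
    proof (rule correct_while[where I = I, OF that])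
      show "\<not> fol_sat u ?\<chi>" if "I x u" for u
        using that i x by (auto simp: I_def)
    next
      fix k u
      assume k: "k < x" and u: "I k u"
      then have "map u (Suc b # b # is) = map real (k # h k # xs)"
        using map_agree[OF v _ b, of u] by (simp add: I_def)
      then have "correct ?body u (I (Suc k))"
        using u
        by (intro correct_Seq computesD[OF \<beta>] correct_Assign) (auto simp: I_def h)
      with k u i x show "fol_sat u ?\<chi> \<and> correct ?body u (I (Suc k))" by (auto simp: I_def)
    qed
    then have "correct (Seq \<alpha> (Seq (Assign (Suc b) (Const 0)) (while ?\<chi> ?body))) v (I x)"
      by (intro correct_Seq computesD[OF \<alpha> v] correct_Assign) (auto simp: I_def h)
    then show "correct (Seq \<alpha> (Seq (Assign (Suc b) (Const 0)) (while ?\<chi> ?body))) v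
      (\<lambda>w. w b = real (rec_nat (f (tl ys)) (\<lambda>k y. g (k # y # tl ys)) (hd ys)) \<and> (\<forall>y<b. w y = v y))"
      by (rule correct_mono) (auto simp: I_def h_def ys)
  qed
qed

text \<open>Variable \<open>b\<close> holds the candidate and \<open>b + 1\<close> the value of
  \<open>f\<close> there; the search goes on while this value is positive. Regularity of
  \<open>f\<close> makes the number of passes, the least zero, well defined.\<close>

lemma computable_mini:
  assumes f: "computable (Suc n) f" and ex: "\<And>xs. length xs = n \<Longrightarrow> \<exists>k. f (k # xs) = 0"
  shows "computable n (\<lambda>xs. LEAST k. f (k # xs) = 0)"
  unfolding computable_def
proof (intro allI impI, elim conjE)
  fix "is" :: "var list" and b
  assume n: "length is = n" and b: "\<forall>i\<in>set is. i < b"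
  then have "\<forall>i\<in>set (b # is). i < Suc b" by auto
  with f n obtain \<alpha> where \<alpha>: "computes \<alpha> (b # is) (Suc b) f"
    unfolding computable_def by (metis length_Cons)
  let ?\<chi> = "FNot (FGeq (Const 0) (Var (Suc b)))"
  let ?body = "Seq (Assign b (Plus (Var b) (Const 1))) \<alpha>"
  show "\<exists>\<alpha>. computes \<alpha> is b (\<lambda>xs. LEAST k. f (k # xs) = 0)"
    unfolding computes_def
  proof (intro exI allI impI)
    fix v :: state and xs :: "nat list"
    assume v: "map v is = map real xs"
    \<comment> \<open>Regularity is given only for argument lists of length
      \<open>n\<close>.\<close>
    then have len: "length xs = n" using n by (metis length_map)
    let ?N = "LEAST k. f (k # xs) = 0"
    define I where "I k w \<longleftrightarrow> w b = real k \<and> w (Suc b) = real (f (k # xs)) \<and> (\<forall>y<b. w y = v y)"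
      for k and w :: state
    have step: "correct \<alpha> u (I k)" if "u b = real k" "\<forall>y<b. u y = v y" for u k
      using that map_agree[OF v that(2) b]
      by (intro computesD[OF \<alpha>, where xs = "k # xs"]) (auto simp: I_def)
    have "correct (while ?\<chi> ?body) u (I ?N)" if "I 0 u" for u
    proof (rule correct_while[where I = I, OF that])
      show "\<not> fol_sat u ?\<chi>" if "I ?N u" for u
        using that LeastI_ex[OF ex[OF len]] by (auto simp: I_def)
    next
      fix k u
      assume k: "k < ?N" and u: "I k u"
      have "correct ?body u (I (Suc k))"
        using u by (intro correct_Seq correct_Assign step) (auto simp: I_def)
      with u not_less_Least[OF k] show "fol_sat u ?\<chi> \<and> correct ?body u (I (Suc k))"
        by (auto simp: I_def)
    qed
    then have "correct (Seq (Assign b (Const 0)) (Seq \<alpha> (while ?\<chi> ?body))) v (I ?N)"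
      by (intro correct_Seq correct_Assign correct_mono[OF step[of _ 0]]) auto
    then show "correct (Seq (Assign b (Const 0)) (Seq \<alpha> (while ?\<chi> ?body))) v
      (\<lambda>w. w b = real ?N \<and> (\<forall>y<b. w y = v y))"
      by (rule correct_mono) (auto simp: I_def)
  qed
qed

lemma recursive_computable: "recursive n f \<Longrightarrow> computable n f"
proof (induction rule: recursive.induct)
  case (zero n)
  have "computes (Assign b (Const 0)) is b (\<lambda>_. 0)" for "is" b
    by (rule computes_Assign) simp
  then show ?case unfolding computable_def by blast
next
  case succ
  show ?case
    unfolding computable_def
  proof (intro allI impI exI)
    fix "is" :: "var list" and b
    assume "length is = 1 \<and> (\<forall>i\<in>set is. i < b)"
    then show "computes (Assign b (Plus (Var (is ! 0)) (Const 1))) is b (\<lambda>xs. Suc (xs ! 0))"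
      by (intro computes_Assign) (auto simp: length_Suc_conv)
  qed
next
  case (proj i n)
  show ?case
    unfolding computable_def
  proof (intro allI impI exI)
    fix "is" :: "var list" and b
    assume "length is = n \<and> (\<forall>i\<in>set is. i < b)"
    then show "computes (Assign b (Var (is ! i))) is b (\<lambda>xs. xs ! i)"
      using proj by (intro computes_Assign) (metis length_map nth_map val.simps(2))
  qed
next
  case (comp gs f n)
  show ?case by (rule computable_comp[OF comp.IH(1)]) (rule comp.IH(2))
next
  case (prim n f g)
  show ?case by (rule computable_prim[OF prim.IH])
next
  case (mini n f)
  show ?case by (rule computable_mini[OF mini.IH mini.hyps(2)])
qed

section \<open>Diagonalisation\<close>

text \<open>This is Cantor pairing, \<open>triangle (m + n) + m\<close>, as a polynomial; halving is
  possible because coefficients are rational.\<close>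

definition pair_trm :: "trm \<Rightarrow> trm \<Rightarrow> trm" where
  "pair_trm s t =
     Plus (Times (Const (1/2)) (Times (Plus s t) (Plus (Plus s t) (Const 1)))) s"

primrec list_trm :: "trm list \<Rightarrow> trm" where
  "list_trm [] = Const 0"
| "list_trm (t # ts) = Plus (pair_trm t (list_trm ts)) (Const 1)"

lemma real_triangle: "real (triangle n) = 1/2 * (real n * (real n + 1))"
  by (induction n) (simp_all add: field_simps)

lemma val_list_trm:
  "map (val v) ts = map real ns \<Longrightarrow> val v (list_trm ts) = real (list_encode ns)"
proof (induction ts arbitrary: ns)
  case (Cons t ts)
  then obtain m ms where "ns = m # ms" "val v t = real m" "map (val v) ts = map real ms"
    by (cases ns) auto
  with Cons.IH[of ms] show ?case
    by (simp add: pair_trm_def prod_encode_def real_triangle of_rat_divide)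
qed simp

definition self_app :: "nat \<Rightarrow> sfml \<Rightarrow> sfml" where
  "self_app n A = BoxS (Assign 0 (Const (of_nat n))) A"

text \<open>The tags are 4 for \<open>BoxS\<close>, then 0 for \<open>Assign\<close> followed by the
  variable 0, then 0 for \<open>Const\<close>. The constant \<open>n\<close> is the fraction
  \<open>n/1\<close>, and \<open>int_encode\<close> doubles nonnegative integers, whence
  \<open>Plus (Var 0) (Var 0)\<close> and 2. The last \<open>Var 0\<close> is the number of the
  formula itself.\<close>

definition self_app_trm :: trm where
  "self_app_trm = list_trm [Const 4, list_trm [Const 0, Const 0,
     list_trm [Const 0, Plus (Var 0) (Var 0), Const 2]], Var 0]"

lemma val_self_app_trm:
  assumes "v 0 = real (code_sfml A)"
  shows "val v self_app_trm = real (code_sfml (self_app (code_sfml A) A))"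
proof -
  let ?n = "code_sfml A"
  have q: "quotient_of (of_nat ?n) = (int ?n, 1)"
    using quotient_of_int[of "int ?n"] by (simp add: Rat.of_int_def)
  have "val v (list_trm [Const 0, Plus (Var 0) (Var 0), Const 2]) = real (code_trm (Const (of_nat ?n)))"
    unfolding code_trm.simps q
    by (rule val_list_trm) (simp add: assms int_encode_def sum_encode_def)
  then have "val v (list_trm [Const 0, Const 0, list_trm [Const 0, Plus (Var 0) (Var 0), Const 2]]) =
      real (code_prog (Assign 0 (Const (of_nat ?n))))"
    unfolding code_prog.simps by (intro val_list_trm) simp
  then show ?thesis
    unfolding self_app_trm_def self_app_def code_sfml.simps
    by (intro val_list_trm) (simp add: assms)
qed

section \<open>A formula expressing unprovability\<close>

text \<open>Started at 0, this loop guesses an arbitrary natural number; a box over it is a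
  quantifier over all candidate proofs.\<close>

lemma rel_increments: "(rel (traces (Assign x (Plus (Var x) (Const 1)))))\<^sup>*\<^sup>* v w \<longleftrightarrow>
  (\<exists>k. w = v(x := v x + real k))"
proof
  assume "(rel (traces (Assign x (Plus (Var x) (Const 1)))))\<^sup>*\<^sup>* v w"
  then show "\<exists>k. w = v(x := v x + real k)"
  proof induction
    case base
    show ?case by (rule exI[of _ 0]) simp
  next
    case (step u w)
    then obtain k where "u = v(x := v x + real k)" by blast
    with step(2) have "w = v(x := v x + real (Suc k))"
      by (simp add: rel_Assign add_ac del: traces.simps)
    then show ?case by blast
  qed
next
  have "(rel (traces (Assign x (Plus (Var x) (Const 1)))))\<^sup>*\<^sup>* v (v(x := v x + real k))" for k
  proof (induction k)
    case (Suc k)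
    then show ?case
      by (rule rtranclp.rtrancl_into_rtrancl) (simp add: rel_Assign fun_eq_iff del: traces.simps)
  qed simp
  then show "\<exists>k. w = v(x := v x + real k) \<Longrightarrow>
    (rel (traces (Assign x (Plus (Var x) (Const 1)))))\<^sup>*\<^sup>* v w" by blast
qed

lemma unprovability_formula:
  assumes "effective C"
  obtains A where "\<And>v. v 0 = real (code_sfml A) \<Longrightarrow>
    sat v A \<longleftrightarrow> \<not> provable C (self_app (code_sfml A) A)"
proof -
  obtain f where "recursive 2 f" and f: "\<And>p \<phi>. f [p, code_sfml \<phi>] = (if C p \<phi> then 1 else 0)"
    using assms unfolding effective_def by blast
  then obtain \<alpha> where \<alpha>: "computes \<alpha> [1, 2] 3 f"
    using recursive_computable[of 2 f] unfolding computable_def by force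
  define \<beta> where "\<beta> = Seq (Assign 2 self_app_trm) \<alpha>"
  \<comment> \<open>Variable 0 holds the number of a formula, 1 the guessed proof, 2 the number of
    the self-application and 3 the verdict of the proof checker. The number of \<open>A\<close> does
    not occur in \<open>A\<close>, so there is no circularity.\<close>
  define A where "A = BoxS (Seq (Assign 1 (Const 0))
    (Seq (Loop (Assign 1 (Plus (Var 1) (Const 1)))) \<beta>)) (Not (Geq (Var 3) (Const 1)))"
  show ?thesis
  proof
    fix v :: state
    assume v: "v 0 = real (code_sfml A)"
    let ?G = "self_app (code_sfml A) A"
    let ?v = "\<lambda>p. v(1 := real p)"
    have rel: "rel (traces (Seq (Assign 1 (Const 0))
        (Seq (Loop (Assign 1 (Plus (Var 1) (Const 1)))) \<beta>))) v w \<longleftrightarrow>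
      (\<exists>p. rel (traces \<beta>) (?v p) w)" for w
      unfolding rel_Seq[of _ "Seq _ _"] rel_Seq[of "Loop _"] rel_Loop OO_def rel_increments
        rel_Assign[of 1 "Const 0"] by auto
    have run: "correct \<beta> (?v p) (\<lambda>w. w 3 = (if C p ?G then 1 else 0))" for p
      unfolding \<beta>_def
    proof (rule correct_Seq, rule correct_Assign, rule computesD[OF \<alpha>])
      have "val (?v p) self_app_trm = real (code_sfml ?G)"
        by (rule val_self_app_trm) (simp add: v)
      then show "map ((?v p)(2 := val (?v p) self_app_trm)) [1, 2] = map real [p, code_sfml ?G]"
        by simp
    qed (simp add: f)
    \<comment> \<open>If \<open>p\<close> is a proof, totality provides a run, and it ends with
      verdict 1; otherwise every run ends with verdict 0.\<close>
    have accept: "C p ?G \<longleftrightarrow> (\<exists>w. rel (traces \<beta>) (?v p) w \<and> w 3 \<ge> 1)" for p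
      using run[of p] by (cases "C p ?G") (force simp: correct_def)+
    have "sat v A \<longleftrightarrow> (\<forall>p w. rel (traces \<beta>) (?v p) w \<longrightarrow> \<not> w 3 \<ge> 1)"
      unfolding A_def sat_BoxS_rel rel by auto
    also have "\<dots> \<longleftrightarrow> (\<forall>p. \<not> C p ?G)"
      using accept by blast
    finally show "sat v A \<longleftrightarrow> \<not> provable C ?G" by (simp add: provable_def)
  qed
qed

theorem theorem4p7:
  shows "\<not> (\<exists>C :: calculus. effective C \<and> sound C \<and> complete C)"
proof
  assume "\<exists>C. effective C \<and> sound C \<and> complete C"
  then obtain C where C: "effective C" "sound C" "complete C" by blast
  from C(1) obtain A where A: "\<And>v. v 0 = real (code_sfml A) \<Longrightarrow>
    sat v A \<longleftrightarrow> \<not> provable C (self_app (code_sfml A) A)"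
    by (rule unprovability_formula) blast
  \<comment> \<open>The assignment overwrites variable 0 with the number of \<open>A\<close>, so the
    fixed-point equivalence holds in every state.\<close>
  have "sat v (self_app (code_sfml A) A) \<longleftrightarrow> \<not> provable C (self_app (code_sfml A) A)" for v
    unfolding self_app_def[of "code_sfml A" A] sat_BoxS_rel rel_Assign
    by (simp add: A self_app_def[symmetric])
  then have "valid (self_app (code_sfml A) A) \<longleftrightarrow> \<not> provable C (self_app (code_sfml A) A)"
    by (simp add: valid_def)
  \<comment> \<open>Provability would give validity by soundness and hence unprovability;
    unprovability would give validity and hence provability by completeness.\<close>
  with C show False unfolding sound_def complete_def by blast
qed

end
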